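(* Let $K_h=(N_h,E_h,F_h,C_h)$ be a cubic grid and, for $\Xi\in P\subset\mathbb{R}^{3|N_{h,int}|}$, let $K_\Xi=(N_\Xi,E_\Xi,F_\Xi,C_\Xi)$ be the curved grid obtained by the $\Xi$-movement of the nodes of $K_h$ (see context). Let $$P':=\big\{\Xi\in P:\ \mathrm{rank}\big(\mathbb{P}^{\mathcal F}_{K_\Xi}\big)<3|C_h|\big\}$$ be the set of all $\Xi\in P$ such that the matrix $\mathbb{P}^{\mathcal F}_{K_\Xi}$ does not have full rank. Then $P'$ has (Lebesgue) measure zero in $\mathbb{R}^{3|N_{h,int}|}$.
   Context: Cubic grid. Let $\Omega\subset\mathbb{R}^3$ be a bounded domain (closure of a connected open set). A cubic grid $K_h=(N_h,E_h,F_h,C_h)$ on $\Omega$ with edge length $h>0$ is a finite cell complex whose union is $\Omega$ and whose elements ($3$-cells, $C_h$) are cubes which, up to a common rigid rotation $Q$ of $\mathbb{R}^3$, are of the form $\boldsymbol z+[0,h]^3$, $\boldsymbol z\in\mathbb{R}^3$; its faces $F_h$, edges $E_h$ and nodes $N_h$ are the square faces, edges and vertices of these cubes (so each element has 6 faces, each face has 4 nodes, distinct cells of the same dimension have disjoint interiors, and each face belongs to one or two elements). All edges, faces and elements are oriented. $N_{h,int}\subset N_h$ is the set of internal nodes (those not on $\partial\Omega$), $N_{h,b}=N_h\setminus N_{h,int}$. Movement. Let $P_h=[-0.4h,0.4h]^3$ and $P=(P_h)^{|N_{h,int}|}\subset\mathbb{R}^{3|N_{h,int}|}$; write $\Xi=(\dots,\boldsymbol\xi_{\boldsymbol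 n},\dots)\in P$ with $\boldsymbol\xi_{\boldsymbol n}\in P_h$ for $\boldsymbol n\in N_{h,int}$. The moved nodes are $\boldsymbol n_\Xi=\boldsymbol n+Q\boldsymbol\xi_{\boldsymbol n}$ if $\boldsymbol n\in N_{h,int}$ (i.e. $\boldsymbol\xi_{\boldsymbol n}$ are the coordinates of the displacement along the axes of the grid; $Q$ is the identity if the coordinate axes are aligned with the grid) and $\boldsymbol n_\Xi=\boldsymbol n$ if $\boldsymbol n\in N_{h,b}$. The edge $e_\Xi$ corresponding to an edge $e$ with endpoints $\boldsymbol n_1,\boldsymbol n_2$ is the segment joining $\boldsymbol n_{1,\Xi},\boldsymbol n_{2,\Xi}$. The face $f_\Xi$ corresponding to $f\in F_h$ with oriented boundary $[\boldsymbol n_1,\boldsymbol n_2]+[\boldsymbol n_2,\boldsymbol n_3]+[\boldsymbol n_3,\boldsymbol n_4]+[\boldsymbol n_4,\boldsymbol n_1]$ is the piecewise linear surface made of the two triangles with vertices $\boldsymbol n_{1,\Xi},\boldsymbol n_{2,\Xi},\boldsymbol n_{3,\Xi}$ and $\boldsymbol n_{1,\Xi},\boldsymbol n_{3,\Xi},\boldsymbol n_{4,\Xi}$, oriented accordingly. The element $c_\Xi$ corresponding to $c\in C_h$ is the cell whose boundary is the union of the $f_\Xi$ for $f$ a face of $c$. Incidence relations and orientations of $K_\Xi$ are those inherited from $K_h$. Face vectors. For a face $f$ with unit normal $\hat{\boldsymbol n}_f$ given by its orientation, the face vector is $\boldsymbol f=\int_f\hat{\boldsymbol n}_f\,dS\in\mathbb{R}^3$;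 for the piecewise linear face $f_\Xi$ this is the sum of the vector areas of its two oriented triangles. Matrix. For a grid $K$ with faces $F$ and elements $C$, let $\mathbb{D}|_{(c,f)}$ be $+1$ (resp. $-1$) if $f$ is a face of $c$ and the normal of $f$ points out of (resp. into) $c$, and $0$ if $f$ is not a face of $c$. $\mathbb{P}^{\mathcal F}_K$ is the $3|C|\times|F|$ matrix with $3\times1$ blocks $\mathbb{D}|_{(c,f)}\,\boldsymbol f$ in block row $c\in C$ and column $f\in F$. *)

theory Defs
  imports "HOL-Analysis.Analysis" "Jordan_Normal_Form.DL_Rank"
begin

definition bounded_domain :: "(real^3) set \<Rightarrow> bool" where
  "bounded_domain \<Omega> \<longleftrightarrow>
     bounded \<Omega> \<and> (\<exists>U. open U \<and> connected U \<and> U \<noteq> {} \<and> \<Omega> = closure U)"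

definition cube :: "real^3^3 \<Rightarrow> real \<Rightarrow> real^3 \<Rightarrow> (real^3) set" where
  "cube Q h z = (\<lambda>x. Q *v x) ` cbox z (z + (\<chi> i. h))"

text \<open>A grid is given by the set \<open>C\<close> of its elements; the cells of lower dimension are the
  proper faces of the elements. The cell complex condition is that two elements
  meet in a (possibly empty) common face. For equally sized and parallel cubes this says the same
  as: distinct cells of the same dimension have disjoint relative interiors.\<close>

definition cubic_grid :: "(real^3) set \<Rightarrow> real^3^3 \<Rightarrow> real \<Rightarrow> (real^3) set set \<Rightarrow> bool" where
  "cubic_grid \<Omega> Q h C \<longleftrightarrow>
     h > 0 \<and> rotation_matrix Q \<and> finite C \<and>
     (\<forall>c\<in>C. \<exists>z. c = cube Q h z) \<and>
     (\<forall>c\<in>C. \<forall>c'\<in>C. (c \<inter> c') face_of c \<and> (c \<inter> c') face_of c') \<and>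
     \<Union>C = \<Omega>"

definition grid_faces :: "(real^3) set set \<Rightarrow> (real^3) set set" where
  "grid_faces C = {f. \<exists>c\<in>C. f facet_of c}"

definition grid_nodes :: "(real^3) set set \<Rightarrow> (real^3) set" where
  "grid_nodes C = {n. \<exists>c\<in>C. n extreme_point_of c}"

definition internal_nodes :: "(real^3) set \<Rightarrow> (real^3) set set \<Rightarrow> (real^3) set" where
  "internal_nodes \<Omega> C = {n \<in> grid_nodes C. n \<notin> frontier \<Omega>}"

text \<open>The orientation of a face \<open>f\<close> is given by its oriented boundary
  \<open>[n1,n2] + [n2,n3] + [n3,n4] + [n4,n1]\<close>, recorded as \<open>bd f = (n1, n2, n3, n4)\<close>. Orientations of
  edges and elements do not enter the matrix below and are not recorded.\<close>

type_synonym face_boundary = "(real^3) set \<Rightarrow> (real^3) \<times> (real^3) \<times> (real^3) \<times> (real^3)"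

definition oriented_faces :: "(real^3) set set \<Rightarrow> face_boundary \<Rightarrow> bool" where
  "oriented_faces C bd \<longleftrightarrow>
     (\<forall>f\<in>grid_faces C. case bd f of (n1, n2, n3, n4) \<Rightarrow>
        distinct [n1, n2, n3, n4] \<and>
        closed_segment n1 n2 edge_of f \<and> closed_segment n2 n3 edge_of f \<and>
        closed_segment n3 n4 edge_of f \<and> closed_segment n4 n1 edge_of f)"

text \<open>The space \<open>\<real>\<close> to the power \<open>3 |N\<^sub>i\<^sub>n\<^sub>t|\<close> is rendered as the set of extensional functions from
  the internal nodes to \<open>\<real>\<^sup>3\<close>, with the completed product of the Lebesgue measures on \<open>\<real>\<^sup>3\<close>.\<close>

definition displacements :: "(real^3) set \<Rightarrow> real \<Rightarrow> (real^3) set set \<Rightarrow> (real^3 \<Rightarrow> real^3) set" where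
  "displacements \<Omega> h C =
     (\<Pi>\<^sub>E n\<in>internal_nodes \<Omega> C. cbox (\<chi> i. - (0.4 * h)) (\<chi> i. 0.4 * h))"

definition displacement_measure ::
    "(real^3) set \<Rightarrow> (real^3) set set \<Rightarrow> (real^3 \<Rightarrow> real^3) measure" where
  "displacement_measure \<Omega> C = completion (\<Pi>\<^sub>M n\<in>internal_nodes \<Omega> C. lborel)"

definition moved_node ::
    "(real^3) set \<Rightarrow> real^3^3 \<Rightarrow> (real^3) set set \<Rightarrow> (real^3 \<Rightarrow> real^3) \<Rightarrow> real^3 \<Rightarrow> real^3" where
  "moved_node \<Omega> Q C \<Xi> n = (if n \<in> internal_nodes \<Omega> C then n + Q *v \<Xi> n else n)"

text \<open>A piecewise linear oriented surface is the list of its oriented triangles; \<open>piecewise_face m q\<close>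
  is the face spanned by the images under \<open>m\<close> of the nodes \<open>q\<close> of an oriented boundary.
  The integral of the unit normal over a triangle with vertices \<open>a, b, c\<close> is half of
  \<open>(b - a) \<times> (c - a)\<close>.\<close>

type_synonym triangle = "(real^3) \<times> (real^3) \<times> (real^3)"

definition piecewise_face ::
    "(real^3 \<Rightarrow> real^3) \<Rightarrow> (real^3) \<times> (real^3) \<times> (real^3) \<times> (real^3) \<Rightarrow> triangle list" where
  "piecewise_face m q = (case q of (n1, n2, n3, n4) \<Rightarrow>
     [(m n1, m n2, m n3), (m n1, m n3, m n4)])"

definition vector_area :: "triangle \<Rightarrow> real^3" where
  "vector_area t = (case t of (a, b, c) \<Rightarrow> (1/2) *\<^sub>R cross3 (b - a) (c - a))"

definition face_vector :: "triangle list \<Rightarrow> real^3" where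
  "face_vector ts = (\<Sum>t\<leftarrow>ts. vector_area t)"

text \<open>An unmoved face is a flat square, so its unit normal is its normalised face vector.\<close>

definition face_normal :: "face_boundary \<Rightarrow> (real^3) set \<Rightarrow> real^3" where
  "face_normal bd f = sgn (face_vector (piecewise_face (\<lambda>n. n) (bd f)))"

definition points_out_of :: "real^3 \<Rightarrow> (real^3) set \<Rightarrow> (real^3) set \<Rightarrow> bool" where
  "points_out_of v f c \<longleftrightarrow> (\<forall>x\<in>c. \<forall>y\<in>f. v \<bullet> (x - y) \<le> 0)"

definition points_into :: "real^3 \<Rightarrow> (real^3) set \<Rightarrow> (real^3) set \<Rightarrow> bool" where
  "points_into v f c \<longleftrightarrow> (\<forall>x\<in>c. \<forall>y\<in>f. v \<bullet> (x - y) \<ge> 0)"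

definition incidence :: "face_boundary \<Rightarrow> (real^3) set \<Rightarrow> (real^3) set \<Rightarrow> real" where
  "incidence bd c f =
     (if f facet_of c \<and> points_out_of (face_normal bd f) f c then 1
      else if f facet_of c \<and> points_into (face_normal bd f) f c then -1
      else 0)"

text \<open>The matrix of a grid with incidence numbers \<open>D\<close> and face vectors \<open>fv\<close>, where \<open>cs\<close> and \<open>fs\<close>
  enumerate its elements and faces: row \<open>3k + l\<close> belongs to component \<open>l + 1\<close> of element \<open>k\<close>.\<close>

definition face_matrix ::
    "('c \<Rightarrow> 'f \<Rightarrow> real) \<Rightarrow> ('f \<Rightarrow> real^3) \<Rightarrow> 'c list \<Rightarrow> 'f list \<Rightarrow> real mat" where
  "face_matrix D fv cs fs =
     Matrix.mat (3 * length cs) (length fs)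
       (\<lambda>(r, j). D (cs ! (r div 3)) (fs ! j) * vec_nth (fv (fs ! j)) (of_nat (r mod 3 + 1)))"

text \<open>Elements and faces of the moved grid are labelled by those of the cubic grid, from which they
  inherit incidences and orientations; only the face vectors change.\<close>

definition moved_face_matrix ::
    "(real^3) set \<Rightarrow> real^3^3 \<Rightarrow> (real^3) set set \<Rightarrow> face_boundary \<Rightarrow>
     (real^3) set list \<Rightarrow> (real^3) set list \<Rightarrow> (real^3 \<Rightarrow> real^3) \<Rightarrow> real mat" where
  "moved_face_matrix \<Omega> Q C bd cs fs \<Xi> =
     face_matrix (incidence bd)
       (\<lambda>f. face_vector (piecewise_face (moved_node \<Omega> Q C \<Xi>) (bd f))) cs fs"

end

theory Submission
  imports Defs
begin

text \<open>For the matrix \<open>A \<Xi>\<close> of the moved grid the Gram determinant \<open>det (A A\<^sup>T)\<close> is a polynomial in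
  \<open>\<Xi>\<close>, and \<open>A\<close> has full rank wherever it does not vanish. The zero set of a nonzero polynomial is
  a null set, so it suffices that the determinant is nonzero at \<open>\<Xi> = 0\<close>, that is, that the rows
  of the unmoved matrix are independent. A linear relation between them assigns a vector \<open>y c\<close> to
  every element such that, for each face, the normal components of the vectors of its elements
  balance. If some component \<open>y c \<bullet> Q e\<^sub>i\<close> were nonzero, take such a \<open>c\<close> that lies furthest
  in direction \<open>Q e\<^sub>i\<close>: the balance on its upper face in that direction involves no other
  nonzero term.\<close>

section \<open>Zero sets of polynomials\<close>

text \<open>Induction over the factors with Tonelli's theorem. All that is used of a polynomial is a
  dichotomy in each single coordinate: with the others fixed, it vanishes either everywhere or
  almost nowhere. The factors are arbitrary, so the lemma serves twice: for the coordinates of one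
  point, and for the nodes of the grid.\<close>

lemma (in product_sigma_finite) AE_PiM_nonzero:
  fixes f :: "('i \<Rightarrow> 'a) \<Rightarrow> real"
  assumes "finite I" and "f \<in> borel_measurable (Pi\<^sub>M I M)"
    and "\<And>x i. x \<in> space (Pi\<^sub>M I M) \<Longrightarrow> i \<in> I \<Longrightarrow> \<exists>t\<in>space (M i). f (x(i := t)) \<noteq> 0
           \<Longrightarrow> AE t in M i. f (x(i := t)) \<noteq> 0"
    and "x0 \<in> space (Pi\<^sub>M I M)" and "f x0 \<noteq> 0"
  shows "AE x in Pi\<^sub>M I M. f x \<noteq> 0"
  using assms
proof (induction I arbitrary: f x0 rule: finite_induct)
  case empty
  then show ?case
    by (intro AE_I2) (auto simp: space_PiM)
next
  case (insert i I)
  note f [measurable] = insert.prems(1)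
  define g where "g x = f (x(i := x0 i))" for x
  have x0i: "x0 i \<in> space (M i)"
    using insert.prems(3) by (auto simp: space_PiM PiE_iff)
  have upd: "x(i := t) \<in> space (Pi\<^sub>M (insert i I) M)"
    if "x \<in> space (Pi\<^sub>M I M)" "t \<in> space (M i)" for x t
    using that by (simp add: space_PiM PiE_fun_upd)
  have "AE x in Pi\<^sub>M I M. g x \<noteq> 0"
  proof (rule insert.IH)
    show "g \<in> borel_measurable (Pi\<^sub>M I M)"
      unfolding g_def using x0i
      by (intro measurable_compose[OF _ f] measurable_fun_upd[where J = I]) auto
    show "AE t in M j. g (x(j := t)) \<noteq> 0"
      if "x \<in> space (Pi\<^sub>M I M)" "j \<in> I" "\<exists>t\<in>space (M j). g (x(j := t)) \<noteq> 0" for x j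
    proof -
      have "i \<noteq> j" using that insert.hyps by auto
      then have twist: "(x(j := t))(i := x0 i) = (x(i := x0 i))(j := t)" for t
        by (rule fun_upd_twist[symmetric])
      have "\<exists>t\<in>space (M j). f ((x(i := x0 i))(j := t)) \<noteq> 0"
        using that(3) unfolding g_def twist .
      then show ?thesis
        unfolding g_def twist
        using insert.prems(2)[OF upd[OF that(1) x0i], of j] that(2) by blast
    qed
    \<comment> \<open>Points of the smaller product are \<open>undefined\<close> off
      \<open>I\<close>; \<open>g\<close> overwrites the value at \<open>i\<close>, so nothing
      changes for \<open>f\<close>.\<close>
    show "x0(i := undefined) \<in> space (Pi\<^sub>M I M)"
      using insert.prems(3) insert.hyps by (auto simp: space_PiM PiE_iff extensional_def)
    show "g (x0(i := undefined)) \<noteq> 0"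
      using insert.prems(4) by (simp add: g_def)
  qed
  then have "AE x in Pi\<^sub>M I M. AE t in M i. f (x(i := t)) \<noteq> 0"
    using AE_space
  proof eventually_elim
    fix x assume x: "g x \<noteq> 0" "x \<in> space (Pi\<^sub>M I M)"
    \<comment> \<open>Where \<open>g\<close> is nonzero, \<open>x0 i\<close> witnesses that the
      fibre over \<open>x\<close> is not identically zero, so almost all of the fibre is
      nonzero.\<close>
    have "\<exists>t\<in>space (M i). f ((x(i := x0 i))(i := t)) \<noteq> 0"
      using x(1) x0i unfolding g_def fun_upd_upd by blast
    then show "AE t in M i. f (x(i := t)) \<noteq> 0"
      using insert.prems(2)[OF upd[OF x(2) x0i], of i] unfolding fun_upd_upd by blast
  qed
  \<comment> \<open>The measure of the zero set is written as the integral of its indicator, which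
    Tonelli turns into an iterated integral with vanishing inner part.\<close>
  then have inner: "AE x in Pi\<^sub>M I M. (\<integral>\<^sup>+ t. indicator {0} (f (x(i := t))) \<partial>M i) = 0"
  proof eventually_elim
    fix x assume "AE t in M i. f (x(i := t)) \<noteq> 0"
    then have "(\<integral>\<^sup>+ t. indicator {0} (f (x(i := t))) \<partial>M i) = (\<integral>\<^sup>+ t. 0 \<partial>M i)"
      by (intro nn_integral_cong_AE) (auto elim!: AE_mp)
    then show "(\<integral>\<^sup>+ t. indicator {0} (f (x(i := t))) \<partial>M i) = 0" by simp
  qed
  have "(\<integral>\<^sup>+ x. indicator {0} (f x) \<partial>Pi\<^sub>M (insert i I) M)
      = (\<integral>\<^sup>+ x. (\<integral>\<^sup>+ t. indicator {0} (f (x(i := t))) \<partial>M i) \<partial>Pi\<^sub>M I M)"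
    by (rule product_nn_integral_insert) (use insert.hyps in auto)
  also have "\<dots> = 0"
    using nn_integral_cong_AE[OF inner] by simp
  finally have "AE x in Pi\<^sub>M (insert i I) M. indicator {0} (f x) = (0 :: ennreal)"
    by (subst (asm) nn_integral_0_iff_AE) auto
  then show ?case
    by (rule AE_mp) (auto simp: indicator_def)
qed

lemma finite_roots_real_polynomial_function:
  fixes f :: "real \<Rightarrow> real"
  assumes "real_polynomial_function f" and "f s \<noteq> 0"
  shows "finite {t. f t = 0}"
proof -
  obtain a n where f: "f = (\<lambda>x. \<Sum>i\<le>n. a i * x ^ i)"
    using assms(1) real_polynomial_function_iff_sum by blast
  moreover have "\<exists>k\<le>n. a k \<noteq> 0"
    using assms(2) unfolding f by (metis (mono_tags, lifting) atMost_iff mult_zero_left sum.neutral)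
  then show ?thesis
    unfolding f by (simp add: polyfun_finite_roots)
qed

lemma AE_lborel_nonzero_real_polynomial:
  fixes f :: "real \<Rightarrow> real"
  assumes "real_polynomial_function f" and "f s \<noteq> 0"
  shows "AE t in lborel. f t \<noteq> 0"
proof -
  have "AE t in lborel. t \<notin> {t. f t = 0}"
    by (intro AE_not_in finite_imp_null_set_lborel finite_roots_real_polynomial_function[OF assms])
  then show ?thesis by simp
qed

text \<open>Lebesgue measure is the image of a product of one-dimensional ones under the coordinate
  map. Varying one coordinate moves the point along a line, where \<open>f\<close> is a univariate
  polynomial with finitely many roots unless it is zero.\<close>

lemma AE_lborel_nonzero:
  fixes f :: "'a :: euclidean_space \<Rightarrow> real"
  assumes [measurable]: "f \<in> borel_measurable borel"
    and poly: "\<And>x b. real_polynomial_function (\<lambda>t. f (x + t *\<^sub>R b))"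
    and "f y \<noteq> 0"
  shows "AE x in lborel. f x \<noteq> 0"
proof -
  interpret product_sigma_finite "\<lambda>_ :: 'a. lborel :: real measure" ..
  let ?s = "\<lambda>x. \<Sum>b\<in>Basis. x b *\<^sub>R b :: 'a"
  have "AE x in Pi\<^sub>M Basis (\<lambda>_. lborel). f (?s x) \<noteq> 0"
  proof (rule AE_PiM_nonzero)
    fix x b assume b: "b \<in> (Basis :: 'a set)" and "\<exists>t\<in>space lborel. f (?s (x(b := t))) \<noteq> 0"
    then obtain t0 where t0: "f (?s (x(b := t0))) \<noteq> 0" by auto
    define s where "s = ?s (x(b := 0))"
    have line: "?s (x(b := t)) = s + t *\<^sub>R b" for t
      using b by (simp add: s_def sum.remove[of _ b])
    show "AE t in lborel. f (?s (x(b := t))) \<noteq> 0"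
      unfolding line using t0[unfolded line] poly
      by (rule AE_lborel_nonzero_real_polynomial[rotated])
  next
    show "(\<lambda>b\<in>Basis. y \<bullet> b) \<in> space (Pi\<^sub>M Basis (\<lambda>_. lborel))"
      by (auto simp: space_PiM)
    show "f (?s (\<lambda>b\<in>Basis. y \<bullet> b)) \<noteq> 0"
      using assms(3) by (simp add: euclidean_representation)
  qed auto
  then show ?thesis
    by (subst lborel_eq, subst AE_distr_iff) auto
qed

text \<open>The product lemma again, now with one Euclidean factor per index; the dichotomy within a
  factor is the preceding lemma. Being polynomial along every line replaces a formal notion of
  polynomial in several variables.\<close>

lemma AE_PiM_lborel_nonzero:
  fixes f :: "('i \<Rightarrow> 'a :: euclidean_space) \<Rightarrow> real"
  assumes "finite N" and [measurable]: "f \<in> borel_measurable (Pi\<^sub>M N (\<lambda>_. lborel))"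
    and poly: "\<And>x v. real_polynomial_function (\<lambda>t. f (\<lambda>n. x n + t *\<^sub>R v n))"
    and "x0 \<in> space (Pi\<^sub>M N (\<lambda>_. lborel))" and "f x0 \<noteq> 0"
  shows "AE x in Pi\<^sub>M N (\<lambda>_. lborel). f x \<noteq> 0"
proof -
  interpret product_sigma_finite "\<lambda>_ :: 'i. lborel :: 'a measure" ..
  show ?thesis
  proof (rule AE_PiM_nonzero)
    fix x n assume x: "x \<in> space (Pi\<^sub>M N (\<lambda>_. lborel :: 'a measure))" and n: "n \<in> N"
      and "\<exists>u\<in>space lborel. f (x(n := u)) \<noteq> 0"
    then obtain u0 where u0: "f (x(n := u0)) \<noteq> 0" by auto
    show "AE u in lborel. f (x(n := u)) \<noteq> 0"
    proof (rule AE_lborel_nonzero[where y = u0])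
      have "(\<lambda>u. x(n := u)) \<in> borel \<rightarrow>\<^sub>M Pi\<^sub>M N (\<lambda>_. lborel)"
        using x n by (intro measurable_fun_upd[where J = N]) auto
      then show "(\<lambda>u. f (x(n := u))) \<in> borel_measurable borel" by simp
      fix u b
      \<comment> \<open>Moving the single point at \<open>n\<close> along \<open>b\<close> is motion
        along a line of the whole function space, with direction \<open>b\<close> at
        \<open>n\<close> and 0 elsewhere.\<close>
      have "x(n := u + t *\<^sub>R b) = (\<lambda>m. (x(n := u)) m + t *\<^sub>R (if m = n then b else 0))" for t
        by auto
      then show "real_polynomial_function (\<lambda>t. f (x(n := u + t *\<^sub>R b)))"
        by (simp only: poly)
    qed (fact u0)
  qed (use assms in auto)
qed

section \<open>Full row rank and the Gram determinant\<close>

lemma (in vec_space) rank_eq_if_span_cols: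
  assumes "span (set (cols A)) = carrier V"
  shows "rank A = n"
proof -
  \<comment> \<open>The rank is the dimension of the column span as a space of its own; with full
    carrier that space is \<open>V\<close> itself.\<close>
  have "vs (carrier V) = V"
    by (rule partial_object.equality) simp_all
  then show ?thesis
    unfolding rank_def assms using dim_is_n by metis
qed

text \<open>If \<open>B\<close> inverts \<open>A * A\<^sup>T\<close>, then
  \<open>A\<^sup>T * B\<close> is a right inverse of \<open>A\<close>, so every vector lies in the
  column space.\<close>

lemma rank_eq_of_det_gram:
  fixes A :: "real mat"
  assumes A: "A \<in> carrier_mat n m" and det: "Determinant.det (A * A\<^sup>T) \<noteq> 0"
  shows "vec_space.rank n A = n"
proof -
  interpret vec_space "TYPE(real)" n .
  have G: "A * A\<^sup>T \<in> carrier_mat n n" using A by auto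
  obtain B where B: "B \<in> carrier_mat n n" "A * A\<^sup>T * B = 1\<^sub>m n"
    using det_non_zero_imp_unit[OF G det, of "()"]
    unfolding Units_def ring_mat_def by auto
  have "w \<in> col_space A" if w: "w \<in> carrier_vec n" for w
  proof -
    have "A *\<^sub>v (A\<^sup>T *\<^sub>v (B *\<^sub>v w)) = (A * A\<^sup>T * B) *\<^sub>v w"
      using A B(1) w by (simp add: assoc_mult_mat_vec[of _ n m _ n] assoc_mult_mat_vec[of _ n n _ n])
    then have "A *\<^sub>v (A\<^sup>T *\<^sub>v (B *\<^sub>v w)) = w"
      using B(2) w by simp
    moreover have "A\<^sup>T *\<^sub>v (B *\<^sub>v w) \<in> carrier_vec m"
      using A B(1) w by auto
    ultimately show ?thesis
      unfolding col_space_eq[OF A] using A w by auto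
  qed
  moreover have "span (set (cols A)) \<subseteq> carrier_vec n"
    using A cols_dim by (intro span_is_subset2) blast
  ultimately have "span (set (cols A)) = carrier V"
    unfolding col_space_def by (auto simp only: module_vec_simps)
  then show ?thesis by (rule rank_eq_if_span_cols)
qed

text \<open>Over the reals a kernel vector \<open>v\<close> of the Gram matrix satisfies
  |\<open>A\<^sup>T\<close> v|^2 = v . (\<open>A * A\<^sup>T\<close> v) = 0, so it is already killed
  by the transpose.\<close>

lemma det_gram_nonzero:
  fixes A :: "real mat"
  assumes A: "A \<in> carrier_mat n m"
    and inj: "\<And>v. v \<in> carrier_vec n \<Longrightarrow> A\<^sup>T *\<^sub>v v = 0\<^sub>v m \<Longrightarrow> v = 0\<^sub>v n"
  shows "Determinant.det (A * A\<^sup>T) \<noteq> 0"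
proof
  assume "Determinant.det (A * A\<^sup>T) = 0"
  moreover have G: "A * A\<^sup>T \<in> carrier_mat n n" using A by auto
  ultimately obtain v where v: "v \<in> carrier_vec n" "v \<noteq> 0\<^sub>v n" "(A * A\<^sup>T) *\<^sub>v v = 0\<^sub>v n"
    using det_0_iff_vec_prod_zero_field[OF G] by blast
  define w where "w = A\<^sup>T *\<^sub>v v"
  have w: "w \<in> carrier_vec m" using A v by (auto simp: w_def)
  have "scalar_prod w w = scalar_prod v (A *\<^sub>v w)"
    using transpose_vec_mult_scalar[OF A w v(1)] comm_scalar_prod[OF w w] 
    by (simp add: w_def)
  also have "A *\<^sub>v w = 0\<^sub>v n"
    using v A by (simp add: w_def assoc_mult_mat_vec[of _ n m _ n])
  finally have "scalar_prod w w = 0" using v by simp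
  then have "w = 0\<^sub>v m"
    using w by (intro eq_vecI) (auto simp: scalar_prod_def sum_nonneg_eq_0_iff)
  then show False using inj v by (auto simp: w_def)
qed

text \<open>The Leibniz formula makes the determinant an explicit polynomial in the entries, from
  which measurability and polynomial dependence are read off.\<close>

lemma det_gram_expand:
  assumes A: "A \<in> carrier_mat n m"
  shows "Determinant.det (A * A\<^sup>T) = (\<Sum>p | p permutes {0..<n}. signof p *
      (\<Prod>i = 0..<n. \<Sum>k = 0..<m. A $$ (i, k) * A $$ (p i, k)))"
proof -
  have G: "A * A\<^sup>T \<in> carrier_mat n n" using A by auto
  have "(A * A\<^sup>T) $$ (i, p i) = (\<Sum>k = 0..<m. A $$ (i, k) * A $$ (p i, k))"
    if "p permutes {0..<n}" "i \<in> {0..<n}" for p i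
  proof -
    have "p i < n" using permutes_in_image[OF that(1), of i] that(2) by simp
    then show ?thesis using A that by (simp add: scalar_prod_def)
  qed
  then show ?thesis
    unfolding det_def'[OF G] by (auto intro!: sum.cong prod.cong)
qed

section \<open>The unmoved grid\<close>

lemma inner_axis_one [simp]:
  fixes x :: "real^3"
  shows "axis i 1 \<bullet> x = vec_nth x i"
  by (metis cart_eq_inner_axis inner_commute)

lemma rotation_matrix_orthogonal_transformation:
  fixes Q :: "real^3^3"
  assumes "rotation_matrix Q"
  shows "orthogonal_transformation ((*v) Q)"
  using assms by (simp add: rotation_matrix_def orthogonal_transformation_matrix)

lemma rotation_matrix_inner:
  fixes Q :: "real^3^3"
  assumes "rotation_matrix Q"
  shows "(Q *v x) \<bullet> (Q *v y) = x \<bullet> y"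
  using rotation_matrix_orthogonal_transformation[OF assms]
  by (simp add: orthogonal_transformation_def)

lemma rotation_matrix_inj:
  fixes Q :: "real^3^3"
  assumes "rotation_matrix Q"
  shows "inj ((*v) Q)"
  by (rule orthogonal_transformation_inj[OF rotation_matrix_orthogonal_transformation[OF assms]])

section \<open>Upper faces of a cube and their corners\<close>

definition upper_face :: "real^3^3 \<Rightarrow> real \<Rightarrow> real^3 \<Rightarrow> 3 \<Rightarrow> (real^3) set" where
  "upper_face Q h z i =
     (\<lambda>x. Q *v x) ` (cbox z (z + (\<chi> i. h)) \<inter> {x. vec_nth x i = vec_nth z i + h})"

text \<open>A supporting hyperplane gives the face. It is proper because it misses \<open>z\<close>,
  and together with \<open>z\<close> it spans the box affinely, so its dimension is lower by exactly
  one.\<close>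

lemma box_upper_face_facet:
  fixes z :: "real^3"
  assumes "h > 0"
  shows "(cbox z (z + (\<chi> i. h)) \<inter> {x. vec_nth x i = vec_nth z i + h}) facet_of cbox z (z + (\<chi> i. h))"
    (is "?G facet_of ?B")
proof -
  have face: "?G face_of ?B"
    using face_of_Int_supporting_hyperplane_le[of ?B "axis i 1" "vec_nth z i + h"]
    by (simp add: mem_box_cart)
  have top: "x + (vec_nth z i + h - vec_nth x i) *\<^sub>R axis i 1 \<in> ?G" if "x \<in> ?B" for x
    using that assms by (auto simp: mem_box_cart axis_def)
  have zB: "z \<in> ?B" using assms by (simp add: mem_box_cart)
  have zG: "z + h *\<^sub>R axis i 1 \<in> ?G" using top[OF zB] by simp
  have "?G \<noteq> ?B"
  proof
    assume "?G = ?B"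
    then have "z \<in> ?G" using zB by blast
    then show False using assms by simp
  qed
  then have "aff_dim ?G < aff_dim ?B"
    by (intro face_of_aff_dim_lt face) auto
  \<comment> \<open>Each \<open>x\<close> is its projection \<open>q\<close> onto the plane of the
    face plus a multiple of the direction from \<open>z + h *\<^sub>R axis i 1\<close> back to
    \<open>z\<close>, all within the hull.\<close>
  moreover have "?B \<subseteq> affine hull (insert z ?G)" 
  proof
    fix x assume "x \<in> ?B"
    define q where "q = x + (vec_nth z i + h - vec_nth x i) *\<^sub>R axis i 1"
    define s where "s = (vec_nth z i + h - vec_nth x i) / h"
    have "x = q + s *\<^sub>R (z - (z + h *\<^sub>R axis i 1))"
      using assms by (simp add: q_def s_def)
    moreover have "q + s *\<^sub>R (z - (z + h *\<^sub>R axis i 1)) \<in> affine hull (insert z ?G)"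
      by (intro mem_affine_3_minus affine_affine_hull hull_inc)
        (use top[OF \<open>x \<in> ?B\<close>] zG in \<open>auto simp only: q_def\<close>)
    ultimately show "x \<in> affine hull (insert z ?G)" by simp
  qed
  then have "aff_dim ?B \<le> aff_dim (insert z ?G)"
    by (metis aff_dim_affine_hull aff_dim_subset)
  then have "aff_dim ?B \<le> aff_dim ?G + 1"
    by (auto simp: aff_dim_insert split: if_splits)
  ultimately show ?thesis
    using face zG unfolding facet_of_def by auto
qed

lemma upper_face_facet:
  assumes "h > 0" and "rotation_matrix Q"
  shows "upper_face Q h z i facet_of cube Q h z"
proof -
  have lin: "linear ((*v) Q)" by simp
  show ?thesis
    using box_upper_face_facet[OF assms(1), of z i] rotation_matrix_inj[OF assms(2)]
    unfolding facet_of_def upper_face_def cube_def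
    by (auto simp: face_of_linear_image[OF lin] aff_dim_injective_linear_image[OF lin])
qed

text \<open>A coordinate strictly between its bounds could be shifted both ways inside the face,
  making the point a midpoint. Coordinate \<open>i\<close> is constant on the face, so the shift is
  in another direction.\<close>

lemma extreme_point_of_box_upper_face:
  fixes z :: "real^3"
  assumes "h > 0"
    and m: "m extreme_point_of (cbox z (z + (\<chi> i. h)) \<inter> {x. vec_nth x i = vec_nth z i + h})"
      (is "_ extreme_point_of ?G")
  shows "vec_nth m k = vec_nth z k \<or> vec_nth m k = vec_nth z k + h"
proof (rule ccontr)
  assume neq: "\<not> ?thesis"
  have mG: "m \<in> ?G" using m by (simp add: extreme_point_of_def)
  have mi: "vec_nth m i = vec_nth z i + h"
    using mG by simp
  then have ki: "k \<noteq> i" using neq by auto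
  have mk: "vec_nth z k < vec_nth m k" "vec_nth m k < vec_nth z k + h"
    using mG neq by (auto simp: mem_box_cart less_le)
  \<comment> \<open>The distance to the nearer bound: shifts by at most \<open>e\<close> in either
    direction stay in the box.\<close>
  define e where "e = min (vec_nth m k - vec_nth z k) (vec_nth z k + h - vec_nth m k)"
  have e: "e > 0" using mk by (simp add: e_def)
  have ends: "m + s *\<^sub>R axis k 1 \<in> ?G" if "\<bar>s\<bar> \<le> e" for s
    using mG ki that unfolding e_def
    by (auto simp: mem_box_cart axis_def)
  have "m = midpoint (m - e *\<^sub>R axis k 1) (m + e *\<^sub>R axis k 1)"
    by (simp add: midpoint_def scaleR_2[symmetric])
  moreover have "m - e *\<^sub>R axis k 1 \<noteq> m + e *\<^sub>R axis k 1"
  proof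
    assume "m - e *\<^sub>R axis k 1 = m + e *\<^sub>R axis k 1"
    then have "vec_nth (m - e *\<^sub>R axis k 1) k = vec_nth (m + e *\<^sub>R axis k 1) k" by (rule arg_cong)
    then show False using e by (simp add: axis_def)
  qed
  ultimately have "m \<in> open_segment (m - e *\<^sub>R axis k 1) (m + e *\<^sub>R axis k 1)"
    by (metis midpoint_in_open_segment)
  moreover have "m - e *\<^sub>R axis k 1 \<in> ?G" "m + e *\<^sub>R axis k 1 \<in> ?G"
    using ends[of "-e"] ends[of e] e by simp_all
  ultimately show False
    using m unfolding extreme_point_of_def by blast
qed

section \<open>Face vectors of squares\<close>

text \<open>Four distinct corners exhaust the square. The two sum conditions say that points 1, 2
  and points 2, 3 are not opposite, so 1, 3 and 2, 4 are the diagonals, and these are not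
  parallel.\<close>

lemma square_diagonals_independent:
  fixes a b h :: real
  assumes "h > 0"
    and "p1 = a \<or> p1 = a + h" "p2 = a \<or> p2 = a + h" "p3 = a \<or> p3 = a + h" "p4 = a \<or> p4 = a + h"
    and "q1 = b \<or> q1 = b + h" "q2 = b \<or> q2 = b + h" "q3 = b \<or> q3 = b + h" "q4 = b \<or> q4 = b + h"
    and "distinct [(p1, q1), (p2, q2), (p3, q3), (p4, q4)]"
    and "p1 + p2 \<noteq> p3 + p4 \<or> q1 + q2 \<noteq> q3 + q4"
    and "p2 + p3 \<noteq> p4 + p1 \<or> q2 + q3 \<noteq> q4 + q1"
  shows "(p3 - p1) * (q4 - q2) \<noteq> (q3 - q1) * (p4 - p2)"
  proof -
  \<comment> \<open>Encoding each coordinate as lower or upper bound reduces the claim to a finite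
    propositional check.\<close>
  have bit: "\<exists>P. p = r + h * of_bool P" if "p = r \<or> p = r + h" for p r
    using that by (metis add.right_neutral mult.right_neutral mult_zero_right of_bool_eq)
  obtain P1 P2 P3 P4 Q1 Q2 Q3 Q4 :: bool where
    "p1 = a + h * of_bool P1" "p2 = a + h * of_bool P2"
    "p3 = a + h * of_bool P3" "p4 = a + h * of_bool P4"
    "q1 = b + h * of_bool Q1" "q2 = b + h * of_bool Q2"
    "q3 = b + h * of_bool Q3" "q4 = b + h * of_bool Q4"
    using assms(2-9)[THEN bit] by blast
  note eqs = this
  have "(P1, Q1) \<noteq> (P2, Q2)" "(P1, Q1) \<noteq> (P3, Q3)" "(P1, Q1) \<noteq> (P4, Q4)"
    "(P2, Q2) \<noteq> (P3, Q3)" "(P2, Q2) \<noteq> (P4, Q4)" "(P3, Q3) \<noteq> (P4, Q4)"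
    using assms(10) eqs by (metis (no_types) Pair_inject distinct_length_2_or_more)+
  \<comment> \<open>If 1, 2 and 3, 4 were pairs of opposite corners, both pairs would have the
    centre of the square as midpoint, contrary to the first sum condition.\<close>
  moreover have "\<not> (P1 = (\<not> P2) \<and> P3 = (\<not> P4) \<and> Q1 = (\<not> Q2) \<and> Q3 = (\<not> Q4))"
  proof
    assume *: "P1 = (\<not> P2) \<and> P3 = (\<not> P4) \<and> Q1 = (\<not> Q2) \<and> Q3 = (\<not> Q4)"
    have "p1 + p2 = p3 + p4" using * eqs(1-4) by (cases P2; cases P4; simp)
    moreover have "q1 + q2 = q3 + q4" using * eqs(5-8) by (cases Q2; cases Q4; simp)
    ultimately show False using assms(11) by blast
  qed
  moreover have "\<not> (P2 = (\<not> P3) \<and> P4 = (\<not> P1) \<and> Q2 = (\<not> Q3) \<and> Q4 = (\<not> Q1))"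
  proof
    assume *: "P2 = (\<not> P3) \<and> P4 = (\<not> P1) \<and> Q2 = (\<not> Q3) \<and> Q4 = (\<not> Q1)"
    have "p2 + p3 = p4 + p1" using * eqs(1-4) by (cases P3; cases P1; simp)
    moreover have "q2 + q3 = q4 + q1" using * eqs(5-8) by (cases Q3; cases Q1; simp)
    ultimately show False using assms(12) by blast
  qed
  \<comment> \<open>What remains are the cyclic traversals: 1, 3 and 2, 4 are opposite, while 1 and
    2 differ in exactly one coordinate.\<close>
  ultimately have "P3 = (\<not> P1) \<and> Q3 = (\<not> Q1) \<and> P4 = (\<not> P2) \<and> Q4 = (\<not> Q2)
      \<and> (P1 = P2) = (Q1 \<noteq> Q2)"
    by (cases P1; cases P2; cases Q1; cases Q2; simp) argo+
  then show ?thesis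
    using \<open>h > 0\<close> unfolding eqs
    by (cases P1; cases P2; cases Q1; cases Q2; simp)
qed

text \<open>With a common midpoint, the face property would pull \<open>c\<close> into the segment
  from \<open>a\<close> to \<open>b\<close>, where an extreme point can only be an endpoint. This
  excludes that consecutive nodes of an oriented boundary are opposite corners.\<close>

lemma closed_segment_not_diagonal:
  fixes S :: "'a :: euclidean_space set"
  assumes face: "closed_segment a b face_of S"
    and "c extreme_point_of S" and "d extreme_point_of S"
    and "distinct [a, b, c, d]"
  shows "a + b \<noteq> c + d"
proof
  assume sum: "a + b = c + d"
  have "midpoint a b = midpoint c d" using sum by (simp add: midpoint_def)
  moreover have "midpoint c d \<in> open_segment c d" using assms(4) by simp
  moreover have "midpoint a b \<in> closed_segment a b" by simp
  ultimately have "c \<in> closed_segment a b"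
    using face assms(2,3) unfolding face_of_def extreme_point_of_def by metis
  then have "c extreme_point_of closed_segment a b"
    using extreme_point_of_face[OF face] assms(2) by blast
  then show False using assms(4) by (auto simp: extreme_point_of_segment)
qed

text \<open>The two triangles share the diagonal from \<open>a\<close> to \<open>c\<close>, so their
  cross products combine by bilinearity and antisymmetry. Planarity plays no part, so the formula
  also covers moved faces.\<close>

lemma face_vector_quadrilateral:
  "face_vector (piecewise_face m (a, b, c, d)) = (1/2) *\<^sub>R cross3 (m c - m a) (m d - m b)"
proof -
  have "cross3 (m b - m a) (m c - m a) + cross3 (m c - m a) (m d - m a) = cross3 (m c - m a) (m d - m b)"
    unfolding Finite_Cartesian_Product.vec_eq_iff forall_3
    by (simp add: cross3_def algebra_simps)
  then show ?thesis
    by (simp add: face_vector_def piecewise_face_def vector_area_def scaleR_add_right[symmetric])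
qed

text \<open>Both diagonals are orthogonal to axis \<open>i\<close>, so their cross product is
  parallel to it; its component there is the determinant of the diagonals in the other two
  coordinates.\<close>

lemma cross3_square_diagonals:
  fixes a b c d z :: "real^3"
  assumes h: "h > 0"
    and a: "\<And>k. vec_nth a k = vec_nth z k \<or> vec_nth a k = vec_nth z k + h"
    and b: "\<And>k. vec_nth b k = vec_nth z k \<or> vec_nth b k = vec_nth z k + h"
    and c: "\<And>k. vec_nth c k = vec_nth z k \<or> vec_nth c k = vec_nth z k + h"
    and d: "\<And>k. vec_nth d k = vec_nth z k \<or> vec_nth d k = vec_nth z k + h"
    and plane: "vec_nth b i = vec_nth a i" "vec_nth c i = vec_nth a i" "vec_nth d i = vec_nth a i"
    and dist: "distinct [a, b, c, d]"
    and sums: "a + b \<noteq> c + d" "b + c \<noteq> d + a"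
  obtains \<alpha> where "\<alpha> \<noteq> 0" "cross3 (c - a) (d - b) = \<alpha> *\<^sub>R axis i 1"
proof -
  have indep: "(vec_nth c k - vec_nth a k) * (vec_nth d l - vec_nth b l)
      \<noteq> (vec_nth c l - vec_nth a l) * (vec_nth d k - vec_nth b k)"
    if kl: "\<And>j. j = i \<or> j = k \<or> j = l" for k l
  proof (rule square_diagonals_independent[OF h a[of k] b[of k] c[of k] d[of k] a[of l] b[of l] c[of l] d[of l]])
    have eq: "x = y" if "vec_nth x i = vec_nth y i" "vec_nth x k = vec_nth y k" "vec_nth x l = vec_nth y l"
      for x y :: "real^3"
      unfolding Finite_Cartesian_Product.vec_eq_iff
    proof
      show "vec_nth x j = vec_nth y j" for j
        using that kl[of j] by auto
    qed
    show "distinct [(vec_nth a k, vec_nth a l), (vec_nth b k, vec_nth b l),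
        (vec_nth c k, vec_nth c l), (vec_nth d k, vec_nth d l)]"
      using dist plane eq[of a b] eq[of a c] eq[of a d] eq[of b c] eq[of b d] eq[of c d] by auto
    show "vec_nth a k + vec_nth b k \<noteq> vec_nth c k + vec_nth d k
        \<or> vec_nth a l + vec_nth b l \<noteq> vec_nth c l + vec_nth d l"
      using sums(1) plane eq[of "a + b" "c + d"] by auto
    show "vec_nth b k + vec_nth c k \<noteq> vec_nth d k + vec_nth a k
        \<or> vec_nth b l + vec_nth c l \<noteq> vec_nth d l + vec_nth a l"
      using sums(2) plane eq[of "b + c" "d + a"] by auto
  qed
  \<comment> \<open>The other two indices are taken in cyclic order, so that \<open>indep\<close>
    matches the component \<open>i\<close> of \<open>cross3\<close>.\<close>
  consider "i = 1" | "i = 2" | "i = 3" using exhaust_3 by blast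
  then show ?thesis
  proof cases
    case 1
    then have idx: "j = i \<or> j = 2 \<or> j = 3" for j
      using exhaust_3[of j] by auto
    have "vec_nth (cross3 (c - a) (d - b)) i \<noteq> 0"
      using indep[of 2 3, OF idx] 1 by (simp add: cross3_def)
    moreover have "cross3 (c - a) (d - b) = vec_nth (cross3 (c - a) (d - b)) i *\<^sub>R axis i 1"
      unfolding Finite_Cartesian_Product.vec_eq_iff forall_3 using plane 1 by (simp add: cross3_def axis_def)
    ultimately show ?thesis by (rule that)
  next
    case 2
    then have idx: "j = i \<or> j = 3 \<or> j = 1" for j
      using exhaust_3[of j] by auto
    have "vec_nth (cross3 (c - a) (d - b)) i \<noteq> 0"
      using indep[of 3 1, OF idx] 2 by (simp add: cross3_def)
    moreover have "cross3 (c - a) (d - b) = vec_nth (cross3 (c - a) (d - b)) i *\<^sub>R axis i 1"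
      unfolding Finite_Cartesian_Product.vec_eq_iff forall_3 using plane 2 by (simp add: cross3_def axis_def)
    ultimately show ?thesis by (rule that)
  next
    case 3
    then have idx: "j = i \<or> j = 1 \<or> j = 2" for j
      using exhaust_3[of j] by auto
    have "vec_nth (cross3 (c - a) (d - b)) i \<noteq> 0"
      using indep[of 1 2, OF idx] 3 by (simp add: cross3_def)
    moreover have "cross3 (c - a) (d - b) = vec_nth (cross3 (c - a) (d - b)) i *\<^sub>R axis i 1"
      unfolding Finite_Cartesian_Product.vec_eq_iff forall_3 using plane 3 by (simp add: cross3_def axis_def)
    ultimately show ?thesis by (rule that)
  qed
qed

text \<open>Endpoints of edges are extreme points, so the recorded nodes are corners, and
  consecutive ones are not opposite; pulled back by \<open>Q\<close>, the square computation
  applies. The sign of \<alpha> reflects the chosen orientation.\<close>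

lemma upper_face_vector:
  assumes h: "h > 0" and Q: "rotation_matrix Q"
    and C: "cube Q h z \<in> C" and ori: "oriented_faces C bd"
  obtains \<alpha> where "\<alpha> \<noteq> 0"
    "face_vector (piecewise_face (\<lambda>n. n) (bd (upper_face Q h z i))) = \<alpha> *\<^sub>R (Q *v axis i 1)"
proof -
  let ?F = "upper_face Q h z i"
  let ?G = "cbox z (z + (\<chi> i. h)) \<inter> {x. vec_nth x i = vec_nth z i + h}"
  have F: "?F = (*v) Q ` ?G" by (simp add: upper_face_def)
  have lin: "linear ((*v) Q)" by simp
  have "?F \<in> grid_faces C"
    using upper_face_facet[OF h Q] C by (auto simp: grid_faces_def)
  moreover obtain n1 n2 n3 n4 where bd: "bd ?F = (n1, n2, n3, n4)" by (metis surj_pair)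
  ultimately have dist: "distinct [n1, n2, n3, n4]"
    and seg: "closed_segment n1 n2 face_of ?F" "closed_segment n2 n3 face_of ?F"
      "closed_segment n3 n4 face_of ?F" "closed_segment n4 n1 face_of ?F"
    using ori unfolding oriented_faces_def edge_of_def by fastforce+
  have ext: "n1 extreme_point_of ?F" "n2 extreme_point_of ?F" "n3 extreme_point_of ?F"
    "n4 extreme_point_of ?F"
    using seg[THEN extreme_point_of_face] by (auto simp: extreme_point_of_segment)
  have pre: "\<exists>m. n = Q *v m \<and> vec_nth m i = vec_nth z i + h \<and>
      (\<forall>k. vec_nth m k = vec_nth z k \<or> vec_nth m k = vec_nth z k + h)"
    if n: "n extreme_point_of ?F" for n
  proof -
    obtain m where m: "m \<in> ?G" "n = Q *v m"
      using n unfolding extreme_point_of_def F by blast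
    have "(*v) Q ` {m} face_of (*v) Q ` ?G"
      using n m unfolding F by (simp add: face_of_singleton)
    then have "m extreme_point_of ?G"
      by (simp only: face_of_linear_image[OF lin rotation_matrix_inj[OF Q]] face_of_singleton)
    then show ?thesis
      using m extreme_point_of_box_upper_face[OF h] by blast
  qed
  obtain m1 where m1: "n1 = Q *v m1" "vec_nth m1 i = vec_nth z i + h"
      "\<And>k. vec_nth m1 k = vec_nth z k \<or> vec_nth m1 k = vec_nth z k + h"
    using pre[OF ext(1)] by blast
  obtain m2 where m2: "n2 = Q *v m2" "vec_nth m2 i = vec_nth z i + h"
      "\<And>k. vec_nth m2 k = vec_nth z k \<or> vec_nth m2 k = vec_nth z k + h"
    using pre[OF ext(2)] by blast
  obtain m3 where m3: "n3 = Q *v m3" "vec_nth m3 i = vec_nth z i + h"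
      "\<And>k. vec_nth m3 k = vec_nth z k \<or> vec_nth m3 k = vec_nth z k + h"
    using pre[OF ext(3)] by blast
  obtain m4 where m4: "n4 = Q *v m4" "vec_nth m4 i = vec_nth z i + h"
      "\<And>k. vec_nth m4 k = vec_nth z k \<or> vec_nth m4 k = vec_nth z k + h"
    using pre[OF ext(4)] by blast
  have "distinct [m1, m2, m3, m4]"
    using dist by (auto simp: m1(1) m2(1) m3(1) m4(1))
  moreover have "n1 + n2 \<noteq> n3 + n4" "n2 + n3 \<noteq> n4 + n1"
    using closed_segment_not_diagonal[OF seg(1) ext(3,4)]
      closed_segment_not_diagonal[OF seg(2) ext(4,1)] dist by auto
  then have "m1 + m2 \<noteq> m3 + m4" "m2 + m3 \<noteq> m4 + m1"
    unfolding m1(1) m2(1) m3(1) m4(1) by (metis matrix_vector_right_distrib)+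
  ultimately obtain \<beta> where \<beta>: "\<beta> \<noteq> 0" "cross3 (m3 - m1) (m4 - m2) = \<beta> *\<^sub>R axis i 1"
    using cross3_square_diagonals[OF h m1(3) m2(3) m3(3) m4(3), of i]
    by (metis m1(2) m2(2) m3(2) m4(2))
  have "cross3 (n3 - n1) (n4 - n2) = Q *v cross3 (m3 - m1) (m4 - m2)"
    using cross_rotation_matrix[OF Q, of "m3 - m1" "m4 - m2"]
    by (simp add: m1(1) m2(1) m3(1) m4(1) matrix_vector_mult_diff_distrib)
  then have "cross3 (n3 - n1) (n4 - n2) = \<beta> *\<^sub>R (Q *v axis i 1)"
    unfolding \<beta>(2) by (simp only: linear_scale[OF lin])
  then show ?thesis
    using \<beta>(1) by (intro that[of "\<beta> / 2"]) (simp_all add: bd face_vector_quadrilateral)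
qed

section \<open>Elements meeting an upper face, and balanced vectors\<close>

text \<open>The cube lies below its upper face in direction \<open>Q *v axis i 1\<close>, and the
  normal is a nonzero multiple of that direction; the sign of \<alpha> decides between out and
  into.\<close>

lemma incidence_upper_face_nonzero:
  assumes h: "h > 0" and Q: "rotation_matrix Q" and \<alpha>: "\<alpha> \<noteq> 0"
    and fv: "face_vector (piecewise_face (\<lambda>n. n) (bd (upper_face Q h z i))) = \<alpha> *\<^sub>R (Q *v axis i 1)"
  shows "incidence bd (cube Q h z) (upper_face Q h z i) \<noteq> 0"
proof -
  let ?F = "upper_face Q h z i" and ?c = "cube Q h z"
  have le: "(Q *v axis i 1) \<bullet> (x - y) \<le> 0" if "x \<in> ?c" "y \<in> ?F" for x y
  proof -
    obtain x' y' where "x = Q *v x'" "vec_nth x' i \<le> vec_nth z i + h"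
        "y = Q *v y'" "vec_nth y' i = vec_nth z i + h"
      using \<open>x \<in> ?c\<close> \<open>y \<in> ?F\<close> unfolding cube_def upper_face_def by (auto simp: mem_box_cart)
    then show ?thesis
      by (simp add: rotation_matrix_inner[OF Q] flip: matrix_vector_mult_diff_distrib)
  qed
  have n: "face_normal bd ?F = (\<alpha> / norm (\<alpha> *\<^sub>R (Q *v axis i 1))) *\<^sub>R (Q *v axis i 1)"
    unfolding face_normal_def fv sgn_div_norm by (simp add: divide_inverse mult.commute)
  have "points_out_of (face_normal bd ?F) ?F ?c \<or> points_into (face_normal bd ?F) ?F ?c"
  proof (cases "\<alpha> > 0")
    case True
    then have "points_out_of (face_normal bd ?F) ?F ?c"
      unfolding points_out_of_def n inner_scaleR_left
      using le by (intro ballI mult_nonneg_nonpos) auto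
    then show ?thesis ..
  next
    case False
    then have "points_into (face_normal bd ?F) ?F ?c"
      unfolding points_into_def n inner_scaleR_left
      using le by (intro ballI mult_nonpos_nonpos) (auto simp: divide_nonpos_nonneg)
    then show ?thesis ..
  qed
  then show ?thesis
    using upper_face_facet[OF h Q] by (auto simp: incidence_def)
qed

text \<open>The smallest and the largest corner of the face lie in the second cube, which forces the
  coordinates other than \<open>i\<close> to agree and coordinate \<open>i\<close> not to decrease.
  Thus any other element having this face lies strictly further in direction
  \<open>i\<close>.\<close>

lemma upper_face_subset_cube:
  assumes h: "h > 0" and Q: "rotation_matrix Q"
    and sub: "upper_face Q h z i \<subseteq> cube Q h z'"
  shows "z' = z \<or> vec_nth z i < vec_nth z' i"
proof -
  have sub': "cbox z (z + (\<chi> i. h)) \<inter> {x. vec_nth x i = vec_nth z i + h} \<subseteq> cbox z' (z' + (\<chi> i. h))"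
    using sub unfolding upper_face_def cube_def inj_image_subset_iff[OF rotation_matrix_inj[OF Q]] .
  have "z + h *\<^sub>R axis i 1 \<in> cbox z' (z' + (\<chi> i. h))"
    using h by (intro subsetD[OF sub']) (auto simp: mem_box_cart axis_def)
  then have lo: "vec_nth z' k \<le> vec_nth z k + h * (if k = i then 1 else 0)" for k
    by (simp add: mem_box_cart axis_def)
  have "z + (\<chi> i. h) \<in> cbox z' (z' + (\<chi> i. h))"
    using h by (intro subsetD[OF sub']) (auto simp: mem_box_cart)
  then have hi: "vec_nth z k \<le> vec_nth z' k" for k
    by (auto simp: mem_box_cart)
  have "z' = z" if "\<not> vec_nth z i < vec_nth z' i"
    unfolding Finite_Cartesian_Product.vec_eq_iff
  proof
    show "vec_nth z' k = vec_nth z k" for k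
      using lo[of k] hi[of k] that by (cases "k = i") auto
  qed
  then show ?thesis by blast
qed

lemma cell_vectors_zero:
  fixes y :: "(real^3) set \<Rightarrow> real^3"
  assumes grid: "cubic_grid \<Omega> Q h C" and ori: "oriented_faces C bd"
    and balance: "\<And>f. f \<in> grid_faces C \<Longrightarrow>
      (\<Sum>c\<in>C. incidence bd c f * (y c \<bullet> face_vector (piecewise_face (\<lambda>n. n) (bd f)))) = 0"
    and "c \<in> C"
  shows "y c = 0"
proof -
  have h: "h > 0" and Q: "rotation_matrix Q" and fin: "finite C"
    and "\<exists>Z. \<forall>c\<in>C. c = cube Q h (Z c)"
    using grid unfolding cubic_grid_def by (auto intro: bchoice)
  then obtain Z where Z: "\<And>c. c \<in> C \<Longrightarrow> c = cube Q h (Z c)" by blast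
  have orth: "y c \<bullet> (Q *v axis i 1) = 0" if "c \<in> C" for c i
  proof (rule ccontr)
    assume "y c \<bullet> (Q *v axis i 1) \<noteq> 0"
    define B where "B = {c \<in> C. y c \<bullet> (Q *v axis i 1) \<noteq> 0}"
    have B: "finite B" "B \<noteq> {}"
      using fin \<open>c \<in> C\<close> \<open>y c \<bullet> _ \<noteq> 0\<close> by (auto simp: B_def)
    \<comment> \<open>Minimising the negated coordinate selects an element of \<open>B\<close>
      furthest in direction \<open>i\<close>.\<close>
    define b where "b = arg_min_on (\<lambda>c. - vec_nth (Z c) i) B"
    have b: "b \<in> B" and max: "\<And>c. c \<in> B \<Longrightarrow> vec_nth (Z c) i \<le> vec_nth (Z b) i"
      using arg_min_if_finite[OF B, of "\<lambda>c. - vec_nth (Z c) i"] by (auto simp: b_def not_less)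
    then have bC: "b \<in> C" and yb: "y b \<bullet> (Q *v axis i 1) \<noteq> 0" by (auto simp: B_def)
    let ?F = "upper_face Q h (Z b) i"
    have bZ: "b = cube Q h (Z b)" using Z[OF bC] .
    obtain \<alpha> where \<alpha>: "\<alpha> \<noteq> 0"
      and fv: "face_vector (piecewise_face (\<lambda>n. n) (bd ?F)) = \<alpha> *\<^sub>R (Q *v axis i 1)"
      using upper_face_vector[OF h Q _ ori, of "Z b" i] bC bZ by metis
    \<comment> \<open>Another element incident with the face lies strictly further than
      \<open>b\<close>, hence outside \<open>B\<close>; its vector is orthogonal to the face vector,
      a multiple of \<open>Q *v axis i 1\<close>.\<close>
    have "incidence bd c ?F * (y c \<bullet> face_vector (piecewise_face (\<lambda>n. n) (bd ?F))) = 0"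
      if c: "c \<in> C - {b}" for c
    proof (cases "incidence bd c ?F = 0")
      case False
      then have "?F \<subseteq> c"
        by (auto simp: incidence_def dest: facet_of_imp_subset split: if_splits)
      then have "Z c = Z b \<or> vec_nth (Z b) i < vec_nth (Z c) i"
        using upper_face_subset_cube[OF h Q] Z c by (metis DiffD1)
      moreover have "Z c \<noteq> Z b" using Z c bZ by (metis DiffD1 DiffD2 singletonI)
      ultimately have "c \<notin> B" using max by force
      then show ?thesis using c fv by (simp add: B_def)
    qed simp
    then have "(\<Sum>c\<in>C - {b}. incidence bd c ?F * (y c \<bullet> face_vector (piecewise_face (\<lambda>n. n) (bd ?F)))) = 0"
      by (rule sum.neutral[OF ballI])
    moreover have "?F \<in> grid_faces C"
      using upper_face_facet[OF h Q, of "Z b" i] bZ bC unfolding grid_faces_def by auto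
    ultimately have "incidence bd b ?F * (y b \<bullet> face_vector (piecewise_face (\<lambda>n. n) (bd ?F))) = 0"
      using balance[of ?F] by (simp only: sum.remove[OF fin bC] add_0_right)
    moreover have "incidence bd b ?F \<noteq> 0"
      using incidence_upper_face_nonzero[where \<alpha> = \<alpha>, OF h Q \<alpha>] fv bZ by metis
    ultimately show False
      using fv \<alpha> yb by simp
  qed
  have "surj ((*v) Q)"
    by (rule orthogonal_transformation_surj[OF rotation_matrix_orthogonal_transformation[OF Q]])
  then obtain x where x: "y c = Q *v x" by (metis surjD)
  have "vec_nth x i = 0" for i
    using orth[OF \<open>c \<in> C\<close>, of i] unfolding x rotation_matrix_inner[OF Q]
    by (metis inner_axis_one inner_commute)
  then have "x = 0" by (simp add: Finite_Cartesian_Product.vec_eq_iff)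
  then show ?thesis using x by simp
qed

section \<open>From the kernel of the transpose to vectors on elements\<close>

text \<open>Three consecutive rows belong to one element, so the matching entries of
  \<open>v\<close> form a vector \<open>w k\<close>, paired with the block by the inner product. A
  kernel vector of the transpose is thus a face balance.\<close>

lemma face_matrix_transpose_mult_index:
  assumes v: "v \<in> carrier_vec (3 * length cs)" and j: "j < length fs"
  defines "w k \<equiv> vector [vec_index v (3 * k), vec_index v (3 * k + 1), vec_index v (3 * k + 2)] :: real^3"
  shows "vec_index ((face_matrix D fv cs fs)\<^sup>T *\<^sub>v v) j
    = (\<Sum>k<length cs. D (cs ! k) (fs ! j) * (w k \<bullet> fv (fs ! j)))"
proof -
  let ?g = "\<lambda>r. D (cs ! (r div 3)) (fs ! j) * vec_nth (fv (fs ! j)) (of_nat (r mod 3 + 1)) * vec_index v r"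
  have "vec_index ((face_matrix D fv cs fs)\<^sup>T *\<^sub>v v) j = (\<Sum>r<length cs * 3. ?g r)"
    using v j by (auto simp: face_matrix_def scalar_prod_def lessThan_atLeast0 mult.commute intro!: sum.cong)
  also have "\<dots> = (\<Sum>k<length cs. \<Sum>r = k * 3..<k * 3 + 3. ?g r)"
    by (rule sum.nat_group[symmetric])
  also have "\<dots> = (\<Sum>k<length cs. D (cs ! k) (fs ! j) * (w k \<bullet> fv (fs ! j)))"
  proof (rule sum.cong)
    fix k :: nat
    have "{k * 3..<k * 3 + 3} = {3 * k, 3 * k + 1, 3 * k + 2}" by auto
    moreover have "(3 * k + 1) div 3 = k" "(3 * k + 2) div 3 = k"
      "(3 * k + 1) mod 3 = 1" "(3 * k + 2) mod 3 = 2" by presburger+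
    ultimately show "(\<Sum>r = k * 3..<k * 3 + 3. ?g r) = D (cs ! k) (fs ! j) * (w k \<bullet> fv (fs ! j))"
      by (simp add: w_def inner_vec_def sum_3 algebra_simps)
  qed simp
  finally show ?thesis .
qed

lemma unmoved_face_matrix_kernel:
  assumes grid: "cubic_grid \<Omega> Q h C" and ori: "oriented_faces C bd"
    and cs: "distinct cs" "set cs = C" and fs: "set fs = grid_faces C"
    and v: "v \<in> carrier_vec (3 * length cs)"
    and ker: "(face_matrix (incidence bd) (\<lambda>f. face_vector (piecewise_face (\<lambda>n. n) (bd f))) cs fs)\<^sup>T *\<^sub>v v
      = 0\<^sub>v (length fs)"
  shows "v = 0\<^sub>v (3 * length cs)"
proof -
  define w where "w k = (vector [vec_index v (3 * k), vec_index v (3 * k + 1), vec_index v (3 * k + 2)] :: real^3)" for k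
  have bij: "bij_betw ((!) cs) {..<length cs} C"
    using cs by (intro bij_betw_nth) auto
  \<comment> \<open>Inverting the enumeration \<open>cs\<close> turns the vectors indexed by
    position into vectors attached to elements.\<close>
  define y where "y c = w (inv_into {..<length cs} ((!) cs) c)" for c
  have yw: "y (cs ! k) = w k" if "k < length cs" for k
    using bij_betw_inv_into_left[OF bij, of k] that by (simp add: y_def)
  have "(\<Sum>c\<in>C. incidence bd c f * (y c \<bullet> face_vector (piecewise_face (\<lambda>n. n) (bd f)))) = 0"
    if f: "f \<in> grid_faces C" for f
  proof -
    obtain j where j: "j < length fs" "fs ! j = f"
      using f fs by (metis in_set_conv_nth)
    have "(\<Sum>c\<in>C. incidence bd c f * (y c \<bullet> face_vector (piecewise_face (\<lambda>n. n) (bd f))))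
        = (\<Sum>k<length cs. incidence bd (cs ! k) f * (y (cs ! k) \<bullet> face_vector (piecewise_face (\<lambda>n. n) (bd f))))"
      by (rule sum.reindex_bij_betw[OF bij, symmetric])
    also have "\<dots> = (\<Sum>k<length cs. incidence bd (cs ! k) f * (w k \<bullet> face_vector (piecewise_face (\<lambda>n. n) (bd f))))"
      by (intro sum.cong) (simp_all add: yw)
    also have "\<dots> = vec_index ((face_matrix (incidence bd)
        (\<lambda>f. face_vector (piecewise_face (\<lambda>n. n) (bd f))) cs fs)\<^sup>T *\<^sub>v v) j"
      unfolding face_matrix_transpose_mult_index[OF v j(1)] j(2) w_def ..
    also have "\<dots> = 0" unfolding ker using j(1) by simp
    finally show ?thesis .
  qed
  then have "y c = 0" if "c \<in> C" for c
    using cell_vectors_zero[OF grid ori, of y c] that by blast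
  then have w0: "w k = 0" if "k < length cs" for k
    using yw[OF that] cs that by auto
  show ?thesis
  proof (rule eq_vecI)
    fix r assume "r < dim_vec (0\<^sub>v (3 * length cs) :: real Matrix.vec)"
    then have r: "r < 3 * length cs" by simp
    have "vec_nth (w (r div 3)) 1 = vec_index v (3 * (r div 3))"
      "vec_nth (w (r div 3)) 2 = vec_index v (3 * (r div 3) + 1)"
      "vec_nth (w (r div 3)) 3 = vec_index v (3 * (r div 3) + 2)"
      by (simp_all add: w_def)
    moreover have "w (r div 3) = 0" using r by (intro w0) auto
    moreover have "r = 3 * (r div 3) \<or> r = 3 * (r div 3) + 1 \<or> r = 3 * (r div 3) + 2"
      by presburger
    ultimately have "vec_index v r = 0" by (metis zero_index)
    then show "vec_index v r = vec_index (0\<^sub>v (3 * length cs)) r" using r by simp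
  qed (use v in simp)
qed

section \<open>The moved grid\<close>

lemma real_polynomial_function_cross3:
  fixes u v :: "real \<Rightarrow> real^3"
  assumes "\<And>k. real_polynomial_function (\<lambda>t. vec_nth (u t) k)"
    and "\<And>k. real_polynomial_function (\<lambda>t. vec_nth (v t) k)"
  shows "real_polynomial_function (\<lambda>t. vec_nth (cross3 (u t) (v t)) l)"
proof -
  consider "l = 1" | "l = 2" | "l = 3" using exhaust_3 by blast
  then show ?thesis
    by cases (auto simp: cross3_def intro!: assms)
qed

lemma real_polynomial_function_moved_node:
  "real_polynomial_function (\<lambda>t. vec_nth (moved_node \<Omega> Q C (\<lambda>n. x n + t *\<^sub>R v n) n) k)"
proof -
  have "bounded_linear (\<lambda>t. t * vec_nth (Q *v v n) k)"
    by (rule bounded_linear_mult_left)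
  then have "real_polynomial_function (\<lambda>t. vec_nth n k + (vec_nth (Q *v x n) k + t * vec_nth (Q *v v n) k))"
    by (intro real_polynomial_function.intros)
  then show ?thesis
    by (cases "n \<in> internal_nodes \<Omega> C")
      (simp_all add: moved_node_def matrix_vector_right_distrib matrix_vector_mult_scaleR
        real_polynomial_function.intros(2))
qed

lemma real_polynomial_function_moved_face_vector:
  "real_polynomial_function (\<lambda>t. vec_nth
     (face_vector (piecewise_face (moved_node \<Omega> Q C (\<lambda>n. x n + t *\<^sub>R v n)) q)) l)"
proof -
  obtain n1 n2 n3 n4 where q: "q = (n1, n2, n3, n4)" by (metis surj_pair)
  have "real_polynomial_function (\<lambda>t. (1/2) * vec_nth
      (cross3 (moved_node \<Omega> Q C (\<lambda>n. x n + t *\<^sub>R v n) n3 - moved_node \<Omega> Q C (\<lambda>n. x n + t *\<^sub>R v n) n1)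
              (moved_node \<Omega> Q C (\<lambda>n. x n + t *\<^sub>R v n) n4 - moved_node \<Omega> Q C (\<lambda>n. x n + t *\<^sub>R v n) n2)) l)"
    unfolding vector_minus_component
    by (intro real_polynomial_function.intros(2,4) real_polynomial_function_cross3)
      (simp_all add: real_polynomial_function_diff real_polynomial_function_moved_node)
  then show ?thesis
    by (simp add: q face_vector_quadrilateral)
qed

lemma measurable_moved_node:
  "(\<lambda>\<Xi>. vec_nth (moved_node \<Omega> Q C \<Xi> n) k)
     \<in> borel_measurable (\<Pi>\<^sub>M n\<in>internal_nodes \<Omega> C. lborel)"
proof (cases "n \<in> internal_nodes \<Omega> C")
  case True
  have [measurable]: "(\<lambda>u. vec_nth (n + Q *v u) k) \<in> borel_measurable borel"
    by (intro borel_measurable_continuous_onI continuous_intros)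
  have "(\<lambda>\<Xi>. \<Xi> n) \<in> (\<Pi>\<^sub>M n\<in>internal_nodes \<Omega> C. lborel) \<rightarrow>\<^sub>M (borel :: (real^3) measure)"
    using measurable_component_singleton[OF True, of "\<lambda>_. lborel :: (real^3) measure"] by simp
  from measurable_compose[OF this \<open>(\<lambda>u. vec_nth (n + Q *v u) k) \<in> _\<close>] show ?thesis
    using True by (simp add: moved_node_def)
qed (simp add: moved_node_def)

lemma measurable_moved_face_vector:
  "(\<lambda>\<Xi>. vec_nth (face_vector (piecewise_face (moved_node \<Omega> Q C \<Xi>) q)) l)
     \<in> borel_measurable (\<Pi>\<^sub>M n\<in>internal_nodes \<Omega> C. lborel)"
proof -
  note measurable_moved_node [measurable]
  obtain n1 n2 n3 n4 where q: "q = (n1, n2, n3, n4)" by (metis surj_pair)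
  consider "l = 1" | "l = 2" | "l = 3" using exhaust_3 by blast
  then show ?thesis
    by cases (simp_all add: q face_vector_quadrilateral cross3_def)
qed

lemma dim_moved_face_matrix:
  "moved_face_matrix \<Omega> Q C bd cs fs \<Xi> \<in> carrier_mat (3 * length cs) (length fs)"
  by (simp add: moved_face_matrix_def face_matrix_def)

text \<open>Cubes are polytopes, which have finitely many extreme points. Finiteness allows the
  induction over the factors of the product measure.\<close>

lemma finite_internal_nodes:
  assumes grid: "cubic_grid \<Omega> Q h C"
  shows "finite (internal_nodes \<Omega> C)"
proof -
  have "finite C"
    using grid unfolding cubic_grid_def by (elim conjE)
  have cubes: "\<forall>c\<in>C. \<exists>z. c = cube Q h z"
    using grid unfolding cubic_grid_def by (elim conjE)
  have "finite {x. x extreme_point_of c}" if "c \<in> C" for c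
  proof -
    obtain z where "c = cube Q h z" using cubes \<open>c \<in> C\<close> by metis
    then have "polytope c"
      unfolding cube_def by (simp add: polytope_linear_image polytope_interval)
    then show ?thesis
      by (intro finite_polyhedron_extreme_points polytope_imp_polyhedron)
  qed
  then have "finite (\<Union>c\<in>C. {x. x extreme_point_of c})"
    using \<open>finite C\<close> by blast
  then show ?thesis
    by (rule rev_finite_subset) (auto simp: internal_nodes_def grid_nodes_def)
qed

theorem theorem7:
  fixes \<Omega> :: "(real^3) set" and Q :: "real^3^3" and h :: real
    and C :: "(real^3) set set" and bd :: face_boundary
    and cs fs :: "(real^3) set list"
  assumes "bounded_domain \<Omega>"
    and "cubic_grid \<Omega> Q h C"
    and "oriented_faces C bd"
    and "distinct cs" and "set cs = C"
    and "distinct fs" and "set fs = grid_faces C"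
  shows "{\<Xi> \<in> displacements \<Omega> h C.
            vec_space.rank (3 * card C) (moved_face_matrix \<Omega> Q C bd cs fs \<Xi>) < 3 * card C}
         \<in> null_sets (displacement_measure \<Omega> C)"
proof -
  let ?N = "internal_nodes \<Omega> C"
  let ?M = "\<Pi>\<^sub>M n\<in>?N. (lborel :: (real^3) measure)"
  define A where "A = moved_face_matrix \<Omega> Q C bd cs fs"
  define n m where "n = 3 * length cs" and "m = length fs"
  define g where "g \<Xi> = Determinant.det (A \<Xi> * (A \<Xi>)\<^sup>T)" for \<Xi>
  have n: "n = 3 * card C"
    using distinct_card[OF assms(4)] assms(5) by (simp add: n_def)
  have A: "A \<Xi> \<in> carrier_mat n m" for \<Xi>
    unfolding A_def n_def m_def by (rule dim_moved_face_matrix)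
  have entry: "A \<Xi> $$ (i, k) = incidence bd (cs ! (i div 3)) (fs ! k) *
      vec_nth (face_vector (piecewise_face (moved_node \<Omega> Q C \<Xi>) (bd (fs ! k)))) (of_nat (i mod 3 + 1))"
    if "i < n" "k < m" for \<Xi> i k
    using that by (simp add: A_def n_def m_def moved_face_matrix_def face_matrix_def)
  have g: "g \<Xi> = (\<Sum>p | p permutes {0..<n}. signof p *
      (\<Prod>i = 0..<n. \<Sum>k = 0..<m. A \<Xi> $$ (i, k) * A \<Xi> $$ (p i, k)))" for \<Xi>
    unfolding g_def by (rule det_gram_expand[OF A])
  have perm: "p i < n" if "p permutes {0..<n}" "i < n" for p i
    using permutes_in_image[OF that(1), of i] that(2) by simp
  have finN: "finite ?N" by (rule finite_internal_nodes[OF assms(2)])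
  \<comment> \<open>The zero displacement, restricted to the internal nodes so as to be a point of
    the product space.\<close>
  define x0 where "x0 = (\<lambda>n\<in>?N. 0 :: real^3)"
  have "AE \<Xi> in ?M. g \<Xi> \<noteq> 0"
  proof (rule AE_PiM_lborel_nonzero[OF finN])
    have "(\<lambda>\<Xi>. A \<Xi> $$ (i, k)) \<in> borel_measurable ?M" if "i < n" "k < m" for i k
      unfolding entry[OF that] by (intro borel_measurable_times measurable_moved_face_vector) simp
    then show "g \<in> borel_measurable ?M"
      unfolding g using perm
      by (intro borel_measurable_sum borel_measurable_times borel_measurable_prod) auto
    fix x v
    have "real_polynomial_function (\<lambda>t. A (\<lambda>n. x n + t *\<^sub>R v n) $$ (i, k))" if "i < n" "k < m" for i k
      unfolding entry[OF that]
      by (intro real_polynomial_function.intros(2,4)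
          real_polynomial_function_moved_face_vector)
    then show "real_polynomial_function (\<lambda>t. g (\<lambda>n. x n + t *\<^sub>R v n))"
      unfolding g using perm
      by (intro real_polynomial_function_sum real_polynomial_function_prod
          real_polynomial_function.intros(2,4)) 
        (auto simp: finite_permutations)
  next
    show "x0 \<in> space ?M" by (simp add: x0_def space_PiM)
    have "moved_node \<Omega> Q C x0 = (\<lambda>n. n)"
      by (auto simp: moved_node_def x0_def)
    then have "A x0 = face_matrix (incidence bd) (\<lambda>f. face_vector (piecewise_face (\<lambda>n. n) (bd f))) cs fs"
      by (simp add: A_def moved_face_matrix_def)
    then show "g x0 \<noteq> 0"
      unfolding g_def
      using unmoved_face_matrix_kernel[OF assms(2,3,4,5,7)]
      by (intro det_gram_nonzero[OF A]) (simp add: n_def m_def)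
  qed
  then have "AE \<Xi> in completion ?M. g \<Xi> \<noteq> 0" by (rule AE_completion)
  then obtain Z where Z: "{\<Xi> \<in> space (completion ?M). \<not> g \<Xi> \<noteq> 0} \<subseteq> Z" "Z \<in> null_sets (completion ?M)"
    unfolding eventually_ae_filter by blast
  \<comment> \<open>Inclusion in the null set \<open>Z\<close> suffices: the measure is complete, so
    measurability of the rank-deficient set comes for free.\<close>
  have "{\<Xi> \<in> displacements \<Omega> h C. vec_space.rank (3 * card C) (A \<Xi>) < 3 * card C} \<subseteq> Z"
  proof
    fix \<Xi> assume \<Xi>: "\<Xi> \<in> {\<Xi> \<in> displacements \<Omega> h C. vec_space.rank (3 * card C) (A \<Xi>) < 3 * card C}"
    then have "\<Xi> \<in> space (completion ?M)"
      by (auto simp: displacements_def space_PiM)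
    moreover have "g \<Xi> = 0"
      using rank_eq_of_det_gram[OF A, of \<Xi>] \<Xi> by (auto simp: g_def n)
    ultimately show "\<Xi> \<in> Z" using Z(1) by auto
  qed
  then show ?thesis
    using Z(2) null_sets_completion_subset unfolding displacement_measure_def A_def by blast
qed

end
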